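(* Let $\delta$ be a positive integer. Let $Q^{(\delta)}_0(x)=1$ and $Q^{(\delta)}_{n+1}(x)=\delta x\,Q^{(\delta)}_n(x)+(1+x^2)\frac{d}{dx}Q^{(\delta)}_n(x)$ for $n\ge0$. Let $(T_n(x))_{n\ge\delta-1}$ be defined by $T_{\delta-1}(x)=1$ and, for $n\ge\delta-1$, $$T_{n+1}(x)=\Bigl(\tfrac{n-\delta+1}{\delta}x^2+x+1+\tfrac{n-\delta+1}{\delta}\Bigr)T_n(x)+\tfrac1\delta\bigl(-x^3+x^2-x+1\bigr)\frac{d}{dx}T_n(x).$$ Then: (i) for all $n\ge0$, $$Q^{(\delta)}_n(x)=\frac{\delta^n(1+x)^n}{2^n}\,T_{n+\delta-1}\!\left(\frac{x-1}{x+1}\right);$$ (ii) $$\sum_{n\ge0}Q^{(\delta)}_n(x)\frac{t^n}{n!}=\frac{1}{(\cos t-x\sin t)^{\delta}};$$ (iii) the ordinary generating function has the Jacobi continued fraction expansion $$\sum_{n=0}^\infty Q^{(\delta)}_n(x)t^n=\cfrac{1}{1-r_0t-\cfrac{s_1t^2}{1-r_1t-\cfrac{s_2t^2}{1-r_2t-\cdots}}},$$ where $r_i=(2i+\delta)x$ for $i\ge0$ and $s_i=i(i+\delta-1)(1+x^2)$ for $i\ge1$.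
   Context: Generating function identities are identities of formal power series in $t$. The $Q^{(\delta)}_n$ are the generalized derivative polynomials for secant: $\frac{d^n}{d\theta^n}\sec^\delta\theta=\sec^\delta\theta\cdot Q^{(\delta)}_n(\tan\theta)$. *)

theory Defs
  imports "HOL-Computational_Algebra.Computational_Algebra"
begin

text \<open>The field of rational functions in the indeterminate x. A polynomial in x is
  regarded as a rational function by \<^const>\<open>to_fract\<close>.\<close>

type_synonym ratfun = "real poly fract"

definition indet :: ratfun where
  "indet = to_fract [:0, 1:]"

text \<open>The value p(f) of a polynomial p with real coefficients at a rational function f;
  a real number a is embedded as the constant rational function \<^term>\<open>to_fract [:a:]\<close>.\<close>

definition subst_ratfun :: "real poly \<Rightarrow> ratfun \<Rightarrow> ratfun" where
  "subst_ratfun p f = poly (map_poly (\<lambda>a. to_fract [:a:]) p) f"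

text \<open>The denominator starting at level i of the truncated J-fraction
  \[ 1 - r_i t - \frac{s_{i+1} t^2}{1 - r_{i+1} t - \frac{s_{i+2} t^2}{\cdots 1 - r_{i+m} t}}. \]
  Its constant coefficient is 1, so all divisions below are by invertible power series.\<close>

fun jfrac_denom :: "(nat \<Rightarrow> 'a::field) \<Rightarrow> (nat \<Rightarrow> 'a) \<Rightarrow> nat \<Rightarrow> nat \<Rightarrow> 'a fps" where
  "jfrac_denom r s i 0 = 1 - fps_const (r i) * fps_X"
| "jfrac_denom r s i (Suc m) =
     1 - fps_const (r i) * fps_X - fps_const (s (Suc i)) * fps_X ^ 2 / jfrac_denom r s (Suc i) m"

text \<open>A formal power series equals an infinite J-fraction if the truncations of the fraction
  converge to it coefficientwise, which is convergence in the metric of the type of formal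
  power series. The value of s at 0 is irrelevant.\<close>

definition has_jfraction :: "'a::field fps \<Rightarrow> (nat \<Rightarrow> 'a) \<Rightarrow> (nat \<Rightarrow> 'a) \<Rightarrow> bool" where
  "has_jfraction F r s \<longleftrightarrow> (\<lambda>m. 1 / jfrac_denom r s 0 m) \<longlonglongrightarrow> F"

end

theory Submission
  imports Defs
begin

text \<open>With \<open>W = cos t - x sin t\<close> and \<open>u = (sin t + x cos t) / W\<close>, one has \<open>u' = 1 + u\<^sup>2\<close>, \<open>u(0) = x\<close>
  and \<open>(W\<^sup>-\<^sup>\<delta>)' = \<delta> u W\<^sup>-\<^sup>\<delta>\<close>, all derivatives being with respect to \<open>t\<close>. Hence the \<open>n\<close>-th derivative
  of \<open>W\<^sup>-\<^sup>\<delta>\<close> is \<open>W\<^sup>-\<^sup>\<delta> Q\<^sub>n(u)\<close>, and \<open>t = 0\<close> gives (ii). Differentiating the identity (i) at \<open>x = u\<close> with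
  respect to \<open>t\<close> turns the recurrence of \<open>Q\<close> into that of \<open>T\<close>, so (i) holds at \<open>u\<close> and, by \<open>t = 0\<close>,
  at \<open>x\<close>. For (iii), the series \<open>f\<^sub>k = W\<^sup>-\<^sup>\<delta> (sin t / W)\<^sup>k / k!\<close> satisfy
  \<open>f\<^sub>k' = f\<^sub>k\<^sub>-\<^sub>1 + r\<^sub>k f\<^sub>k + s\<^sub>k\<^sub>+\<^sub>1 f\<^sub>k\<^sub>+\<^sub>1\<close>, which is the Stieltjes--Rogers criterion for the J-fraction.\<close>

section \<open>Evaluation of real polynomials at power series over the rational functions\<close>

definition subst_fps :: "real poly \<Rightarrow> ratfun fps \<Rightarrow> ratfun fps" where
  "subst_fps p u = poly (map_poly (\<lambda>a. fps_const (to_fract [:a:])) p) u"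

lemma to_fract_const_add: "to_fract [:a + b :: real:] = to_fract [:a:] + to_fract [:b:]"
  by (simp flip: to_fract_add)

lemma to_fract_const_mult: "to_fract [:a * b :: real:] = to_fract [:a:] * to_fract [:b:]"
  by (simp flip: to_fract_mult)

lemma to_fract_const_of_nat: "to_fract [:of_nat n :: real:] = of_nat n"
  by (induction n) (simp_all add: to_fract_const_add flip: one_pCons)

lemma subst_fps_0 [simp]: "subst_fps 0 u = 0"
  by (simp add: subst_fps_def)

lemma subst_fps_pCons [simp]:
  "subst_fps (pCons a p) u = fps_const (to_fract [:a:]) + u * subst_fps p u"
  by (simp add: subst_fps_def map_poly_pCons)

lemma subst_fps_1 [simp]: "subst_fps 1 u = 1"
  by (subst one_pCons, subst subst_fps_pCons) (simp flip: one_pCons)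

lemma subst_fps_add: "subst_fps (p + q) u = subst_fps p u + subst_fps q u"
  by (induction p q rule: poly_induct2)
     (simp_all add: to_fract_const_add algebra_simps flip: fps_const_add)

lemma subst_fps_smult: "subst_fps (smult a p) u = fps_const (to_fract [:a:]) * subst_fps p u"
  by (induction p) (simp_all add: to_fract_const_mult algebra_simps flip: fps_const_mult)

lemma subst_fps_mult: "subst_fps (p * q) u = subst_fps p u * subst_fps q u"
  by (induction p) (simp_all add: subst_fps_add subst_fps_smult algebra_simps)

lemma fps_deriv_subst_fps:
  "fps_deriv (subst_fps p u) = subst_fps (pderiv p) u * fps_deriv u"
  by (induction p) (simp_all add: pderiv_pCons subst_fps_add algebra_simps)

text \<open>Taking the constant coefficient is a ring homomorphism; this carries identities proved
  at the series \<open>u\<close> over to the point \<open>u $ 0\<close>.\<close>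

lemma subst_fps_nth_0: "subst_fps p u $ 0 = subst_ratfun p (u $ 0)"
  by (induction p) (simp_all add: subst_ratfun_def map_poly_pCons)

lemma subst_ratfun_indet: "subst_ratfun p indet = to_fract p"
proof (induction p)
  case (pCons a p)
  have "pCons a p = [:a:] + [:0, 1:] * p" by simp
  then have "to_fract (pCons a p) = to_fract [:a:] + indet * to_fract p"
    by (simp only: indet_def to_fract_add to_fract_mult)
  with pCons show ?case
    by (simp add: subst_ratfun_def map_poly_pCons)
qed (simp add: subst_ratfun_def)

section \<open>The recurrences of Q and T along a solution of \<open>u' = 1 + u ^ 2\<close>\<close>

lemma fps_deriv_power_of_log_deriv:
  fixes f g :: "'a::comm_ring_1 fps"
  assumes "fps_deriv f = g * f"
  shows "fps_deriv (f ^ n) = of_nat n * g * f ^ n"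
  by (induction n) (simp_all add: assms algebra_simps)

text \<open>By the chain rule the factor \<open>1 + u ^ 2\<close> is absorbed into
  \<open>fps_deriv u\<close>, so the recurrence of Q becomes the operator "derivative plus \<delta>
  times \<open>u\<close>".\<close>

lemma subst_fps_secant_step:
  fixes u :: "ratfun fps"
  assumes u: "fps_deriv u = 1 + u ^ 2"
    and Q: "Q' = of_nat \<delta> * [:0, 1:] * Q + [:1, 0, 1:] * pderiv Q"
  shows "subst_fps Q' u = of_nat \<delta> * u * subst_fps Q u + fps_deriv (subst_fps Q u)"
proof -
  have "of_nat \<delta> = [:real \<delta>:]"
    by (simp add: of_nat_poly)
  then have "subst_fps (of_nat \<delta>) u = of_nat \<delta>"
    by (simp add: to_fract_const_of_nat fps_of_nat)
  then show ?thesis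
    by (simp add: Q subst_fps_add subst_fps_mult fps_deriv_subst_fps u power2_eq_square
        algebra_simps flip: one_pCons)
qed

text \<open>Here \<open>1 - 2 e = (u - 1) / (u + 1)\<close>.\<close>

lemma subst_fps_secant_tan_transform:
  fixes u e :: "ratfun fps" and Q S :: "nat \<Rightarrow> real poly"
  assumes u: "fps_deriv u = 1 + u ^ 2" and e: "e * (1 + u) = 1"
    and \<delta>: "\<delta> > 0"
    and Q0: "Q 0 = 1"
    and Q: "\<And>n. Q (Suc n) = of_nat \<delta> * [:0, 1:] * Q n + [:1, 0, 1:] * pderiv (Q n)"
    and S0: "S 0 = 1"
    and S: "\<And>n. S (Suc n) = [:1 + real n / real \<delta>, 1, real n / real \<delta>:] * S n
             + smult (1 / real \<delta>) ([:1, -1, 1, -1:] * pderiv (S n))"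
  shows "2 ^ n * subst_fps (Q n) u = of_nat \<delta> ^ n * (1 + u) ^ n * subst_fps (S n) (1 - 2 * e)"
proof (induction n)
  case 0
  then show ?case by (simp add: Q0 S0)
next
  case (Suc n)
  define y where "y = 1 - 2 * e"
  define A where "A = subst_fps (Q n) u"
  define B where "B = subst_fps (S n) y"
  define C where "C = subst_fps (pderiv (S n)) y"
  define P where "P = (of_nat \<delta> * (1 + u)) ^ n"
  have IH: "2 ^ n * A = P * B"
    using Suc by (simp add: A_def B_def P_def y_def power_mult_distrib)
  have "fps_deriv (e * (1 + u)) = 0"
    by (simp add: e)
  then have "fps_deriv e * (1 + u) + e * (1 + u ^ 2) = 0"
    by (simp add: u algebra_simps)
  then have e': "fps_deriv e = - (e ^ 2) * (1 + u ^ 2)"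
    using e by algebra
  have B': "fps_deriv B = 2 * e ^ 2 * (1 + u ^ 2) * C"
    by (simp add: B_def C_def fps_deriv_subst_fps y_def e' algebra_simps)
  \<comment> \<open>As \<open>e\<close> inverts \<open>1 + u\<close>, the factor
    \<open>e * (1 + u ^ 2)\<close> is the logarithmic derivative of \<open>1 + u\<close>, and
    \<open>P\<close> can be differentiated without splitting on \<open>n\<close>.\<close>
  have w': "fps_deriv (of_nat \<delta> * (1 + u)) = e * (1 + u ^ 2) * (of_nat \<delta> * (1 + u))"
  proof -
    have "fps_deriv (of_nat \<delta> * (1 + u)) = of_nat \<delta> * (1 + u ^ 2)"
      by (simp add: u)
    then show ?thesis using e by algebra
  qed
  have P': "fps_deriv P = of_nat n * (e * (1 + u ^ 2)) * P"
    unfolding P_def fps_deriv_power_of_log_deriv[OF w'] by simp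
  have "fps_deriv (2 ^ n :: ratfun fps) = 0"
    by (subst fps_deriv_power') simp
  then have "2 ^ n * fps_deriv A = fps_deriv (2 ^ n * A)"
    by (simp only: fps_deriv_mult) simp
  also have "\<dots> = P * (of_nat n * e * (1 + u ^ 2) * B + 2 * e ^ 2 * (1 + u ^ 2) * C)"
    unfolding IH by (simp add: P' B' algebra_simps)
  finally have A': "2 ^ n * fps_deriv A =
      P * (of_nat n * e * (1 + u ^ 2) * B + 2 * e ^ 2 * (1 + u ^ 2) * C)" .
  \<comment> \<open>This relation clears the constants 1/\<delta> in the recurrence of
    \<open>S\<close>.\<close>
  have inv: "of_nat \<delta> * fps_const (to_fract [:inverse (real \<delta>):]) = (1 :: ratfun fps)"
  proof -
    have "of_nat \<delta> * to_fract [:inverse (real \<delta>):] = to_fract [:real \<delta> * inverse (real \<delta>):]"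
      by (simp only: to_fract_const_mult to_fract_const_of_nat)
    also have "\<dots> = 1" using \<delta> by (simp flip: one_pCons)
    finally show ?thesis by (simp flip: fps_of_nat)
  qed
  define d where "d = fps_const (to_fract [:inverse (real \<delta>):])"
  have c: "fps_const (to_fract [:- (1::real):]) = - 1"
  proof -
    have "to_fract [:- (1::real):] = to_fract (- 1)"
      by (simp add: one_pCons)
    then show ?thesis
      by (simp only: to_fract_uminus to_fract_1 fps_const_1_eq_1 flip: fps_const_neg)
  qed
  have "subst_fps (S (Suc n)) y =
      (1 + of_nat n * d + y + of_nat n * d * y ^ 2) * B + d * (1 - y + y ^ 2 - y ^ 3) * C"
    unfolding S subst_fps_add subst_fps_mult subst_fps_smult B_def[symmetric] C_def[symmetric]
    by (simp add: c divide_inverse to_fract_const_add to_fract_const_mult to_fract_const_of_nat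
        d_def[symmetric] fps_of_nat power2_eq_square power3_eq_cube algebra_simps
        flip: fps_const_add fps_const_mult one_pCons)
  then have S': "of_nat \<delta> * subst_fps (S (Suc n)) y =
      (of_nat \<delta> + of_nat n + of_nat \<delta> * y + of_nat n * y ^ 2) * B + (1 - y + y ^ 2 - y ^ 3) * C"
    using inv unfolding d_def[symmetric] by algebra
  \<comment> \<open>Since \<open>1 + y = 2 * e * u\<close>,
    \<open>1 + y ^ 2 = 2 * e ^ 2 * (1 + u ^ 2)\<close> and
    \<open>1 - y + y ^ 2 - y ^ 3 = (1 - y) * (1 + y ^ 2)\<close>, the terms in \<open>B\<close> and
    in \<open>C\<close> agree separately.\<close>
  have key: "2 * (of_nat \<delta> * u * B + (of_nat n * e * (1 + u ^ 2) * B + 2 * e ^ 2 * (1 + u ^ 2) * C)) =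
       (1 + u) * (of_nat \<delta> * subst_fps (S (Suc n)) y)"
    using e unfolding S' unfolding y_def by algebra
  have "2 ^ Suc n * subst_fps (Q (Suc n)) u = 2 * (of_nat \<delta> * u * (2 ^ n * A) + 2 ^ n * fps_deriv A)"
    by (simp add: subst_fps_secant_step[OF u Q] A_def algebra_simps)
  also have "\<dots> = P * (2 * (of_nat \<delta> * u * B
      + (of_nat n * e * (1 + u ^ 2) * B + 2 * e ^ 2 * (1 + u ^ 2) * C)))"
    unfolding IH A' by algebra
  also have "\<dots> = P * ((1 + u) * (of_nat \<delta> * subst_fps (S (Suc n)) y))"
    unfolding key ..
  finally show ?case
    by (simp add: P_def y_def power_mult_distrib mult_ac)
qed

section \<open>Derivatives of the secant powers and of the series f_k\<close>

lemma secant_fps_derivs: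
  fixes x :: "'a::field_char_0"
  defines "V \<equiv> inverse (fps_cos 1 - fps_const x * fps_sin 1)"
  defines "u \<equiv> (fps_sin 1 + fps_const x * fps_cos 1) * V"
  shows "fps_deriv (V ^ d) = of_nat d * u * V ^ d"
    and "fps_deriv u = 1 + u ^ 2"
    and "u $ 0 = x"
    and "fps_cos 1 * V = 1 + fps_const x * (fps_sin 1 * V)"
proof -
  define W where "W = fps_cos 1 - fps_const x * fps_sin 1"
  define N where "N = fps_sin 1 + fps_const x * fps_cos 1"
  have VW: "V * W = 1"
    unfolding V_def W_def by (rule inverse_mult_eq_1) simp
  have W': "fps_deriv W = - N" and N': "fps_deriv N = W"
    by (simp_all add: W_def N_def fps_sin_deriv fps_cos_deriv flip: fps_const_neg)
  have uN: "u = N * V" by (simp add: u_def N_def)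
  have "fps_deriv (V * W) = 0" by (simp add: VW)
  then have "fps_deriv V * W = N * V"
    by (simp add: W' algebra_simps)
  then have V': "fps_deriv V = u * V"
    using VW unfolding uN by algebra
  show "fps_deriv (V ^ d) = of_nat d * u * V ^ d"
    by (rule fps_deriv_power_of_log_deriv) (rule V')
  show "fps_deriv u = 1 + u ^ 2"
    using VW unfolding uN by (simp add: N' V' uN power2_eq_square algebra_simps)
  show "u $ 0 = x" by (simp add: u_def V_def)
  show "fps_cos 1 * V = 1 + fps_const x * (fps_sin 1 * V)"
    using VW by (simp add: W_def algebra_simps)
qed

text \<open>Put \<open>Z = fps_sin 1 * V\<close>. As \<open>u = x + (1 + x ^ 2) * Z\<close>,
  differentiating \<open>V ^ (d + k)\<close> gives terms in \<open>f k\<close> and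
  \<open>f (Suc k)\<close>; as \<open>fps_cos 1 * V = 1 + x * Z\<close>, differentiating the sine
  power gives \<open>f (k - 1)\<close> and \<open>k * x * f k\<close>.\<close>

lemma fps_deriv_secant_column:
  fixes x :: "'a::field_char_0" and d k :: nat
  defines "V \<equiv> inverse (fps_cos 1 - fps_const x * fps_sin 1)"
  defines "f \<equiv> \<lambda>k. fps_const (1 / fact k) * V ^ (d + k) * fps_sin 1 ^ k"
  shows "fps_deriv (f k) = (if k = 0 then 0 else f (k - 1)) + fps_const (of_nat (2 * k + d) * x) * f k
           + fps_const (of_nat (Suc k * (d + k)) * (1 + x ^ 2)) * f (Suc k)"
proof -
  note derivs = secant_fps_derivs[of x, folded V_def]
  define Z where "Z = fps_sin 1 * V"
  define c where "c = fps_const x"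
  have cosV: "fps_cos 1 * V = 1 + c * Z"
    using derivs(4) by (simp add: Z_def c_def)
  have u: "(fps_sin 1 + fps_const x * fps_cos 1) * V = c + (1 + c ^ 2) * Z"
  proof -
    have "(fps_sin 1 + fps_const x * fps_cos 1) * V = Z + c * (fps_cos 1 * V)"
      by (simp add: Z_def c_def algebra_simps)
    then show ?thesis unfolding cosV by (simp add: algebra_simps power2_eq_square)
  qed
  have VV: "fps_deriv (V ^ (d + k)) = of_nat (d + k) * (c + (1 + c ^ 2) * Z) * V ^ (d + k)"
    unfolding derivs(1) u ..
  \<comment> \<open>Multiplication by \<open>Z\<close> raises the index, and the change of factorial
    supplies the integer factor.\<close>
  have Zf: "Z * f j = of_nat (Suc j) * f (Suc j)" for j
  proof -
    have "of_nat (Suc j) * fps_const (1 / fact (Suc j)) = fps_const (of_nat (Suc j) * (1 / fact (Suc j)) :: 'a)"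
      by (simp only: fps_const_mult flip: fps_of_nat)
    also have "of_nat (Suc j) * (1 / fact (Suc j)) = (1 / fact j :: 'a)"
      by (simp del: of_nat_Suc)
    finally have "fps_const (1 / fact j :: 'a) = of_nat (Suc j) * fps_const (1 / fact (Suc j))" ..
    then show ?thesis by (simp add: f_def Z_def mult_ac del: of_nat_Suc fact_Suc)
  qed
  have sin': "fps_const (1 / fact k) * V ^ (d + k) * fps_deriv (fps_sin 1 ^ k) =
       (if k = 0 then 0 else f (k - 1)) + c * of_nat k * f k"
  proof (cases k)
    case (Suc j)
    have "fps_const (1 / fact k) * of_nat k = (fps_const (1 / fact j * 1) :: 'a fps)"
      by (simp add: Suc flip: fps_of_nat del: of_nat_Suc)
    moreover have sin_pow: "fps_deriv (fps_sin 1 ^ Suc j) = of_nat (Suc j) * fps_cos 1 * fps_sin (1::'a) ^ j"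
      by (subst fps_deriv_power') (simp add: fps_sin_deriv mult_ac del: of_nat_Suc)
    ultimately have "fps_const (1 / fact k) * V ^ (d + k) * fps_deriv (fps_sin 1 ^ k) = f j * (fps_cos 1 * V)"
      by (simp add: Suc f_def sin_pow mult_ac del: of_nat_Suc fact_Suc power_Suc)
         (simp add: mult_ac del: of_nat_Suc fact_Suc)
    also have "\<dots> = f j + c * (Z * f j)"
      unfolding cosV by (simp add: algebra_simps)
    finally show ?thesis unfolding Zf by (simp add: Suc mult_ac)
  qed simp
  have "fps_deriv (f k) = fps_const (1 / fact k) * V ^ (d + k) * fps_deriv (fps_sin 1 ^ k) +
      of_nat (d + k) * (c * f k + (1 + c ^ 2) * (Z * f k))"
    unfolding f_def by (simp add: VV algebra_simps)
  also have "\<dots> = (if k = 0 then 0 else f (k - 1)) + of_nat (2 * k + d) * c * f k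
       + of_nat (Suc k * (d + k)) * (1 + c ^ 2) * f (Suc k)"
    unfolding sin' Zf by (simp add: algebra_simps)
  also have "of_nat (2 * k + d) * c = fps_const (of_nat (2 * k + d) * x)"
    by (simp only: c_def fps_const_mult flip: fps_of_nat)
  also have "of_nat (Suc k * (d + k)) * (1 + c ^ 2) = fps_const (of_nat (Suc k * (d + k)) * (1 + x ^ 2))"
    by (simp only: c_def fps_const_mult fps_const_add fps_const_power flip: fps_of_nat fps_const_1_eq_1)
  finally show ?thesis .
qed

section \<open>The Stieltjes--Rogers criterion for J-fractions\<close>

lemma jfrac_denom_nth_0 [simp]: "jfrac_denom r s i m $ 0 = (1 :: 'a::field)"
proof (induction m arbitrary: i)
  case (Suc m)
  then show ?case by (simp add: fps_divide_unit)
qed simp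

text \<open>Here \<open>a k n\<close> is the total weight of the nonnegative lattice paths of
  \<open>n\<close> steps from height 0 to height \<open>k\<close>, where rises weigh 1, level steps
  at \<open>i\<close> weigh \<open>r i\<close> and falls from \<open>i\<close> weigh
  \<open>s i\<close>. The three-term relation between the generating functions of the columns
  unrolls into the fraction.\<close>

lemma has_jfractionI:
  fixes a :: "nat \<Rightarrow> nat \<Rightarrow> 'a::field"
  assumes init: "\<And>k. a k 0 = (if k = 0 then 1 else 0)"
    and rec: "\<And>k n. a k (Suc n) =
      (if k = 0 then 0 else a (k - 1) n) + r k * a k n + s (Suc k) * a (Suc k) n"
  shows "has_jfraction (Abs_fps (a 0)) r s"
proof -
  define A where "A k = Abs_fps (a k)" for k
  define B where "B k = (if k = 0 then 1 else fps_X * A (k - 1))" for k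
  have A: "A k = B k + fps_X * (fps_const (r k) * A k + fps_const (s (Suc k)) * A (Suc k))" for k
  proof (rule fps_ext)
    fix n
    show "A k $ n = (B k + fps_X * (fps_const (r k) * A k + fps_const (s (Suc k)) * A (Suc k))) $ n"
      by (cases n) (auto simp: A_def B_def init rec)
  qed
  \<comment> \<open>The exact tail of the fraction at level \<open>k\<close> has denominator \<open>B k / A k\<close>; replacing it by the
    truncated one costs an error whose order grows with the depth \<open>m\<close>.\<close>
  have dvd: "fps_X ^ m dvd jfrac_denom r s k m * A k - B k" for m k
  proof (induction m arbitrary: k)
    case (Suc m)
    define D where "D = jfrac_denom r s (Suc k) m"
    define E where "E = inverse D"
    have ED: "E * D = 1"
      unfolding E_def D_def by (rule inverse_mult_eq_1) simp
    have "jfrac_denom r s k (Suc m) = 1 - fps_const (r k) * fps_X - fps_const (s (Suc k)) * fps_X ^ 2 * E"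
      by (simp add: fps_divide_unit D_def[symmetric] E_def) (simp add: D_def fps_divide_unit)
    moreover have "B (Suc k) = fps_X * A k" by (simp add: B_def)
    ultimately have "jfrac_denom r s k (Suc m) * A k - B k =
        fps_X * (D * A (Suc k) - B (Suc k)) * (fps_const (s (Suc k)) * E)"
      using A[of k] ED by algebra
    moreover have "fps_X ^ Suc m dvd fps_X * (D * A (Suc k) - B (Suc k))"
      using Suc[of "Suc k"] by (simp add: D_def)
    ultimately show ?case by (metis dvd_mult2)
  qed simp
  have eq: "(1 / jfrac_denom r s 0 m) $ n = A 0 $ n" if "n < m" for m n
  proof -
    define D where "D = jfrac_denom r s 0 m"
    obtain R where R: "D * A 0 - 1 = fps_X ^ m * R"
      using dvd[of m 0] by (auto simp: B_def D_def)
    have ED: "inverse D * D = 1"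
      unfolding D_def by (rule inverse_mult_eq_1) simp
    \<comment> \<open>\<open>Y\<close> is the error of the truncation; being a multiple of
      \<open>fps_X ^ m\<close>, it leaves the coefficients below \<open>m\<close> unchanged.\<close>
    define Y where "Y = fps_X ^ m * (R * inverse D)"
    have "Y = inverse D * (D * A 0 - 1)"
      by (simp add: R Y_def mult_ac)
    then have "inverse D = A 0 - Y"
      using ED by algebra
    moreover have "1 / D = inverse D"
      by (subst fps_divide_unit) (simp_all add: D_def)
    ultimately have "1 / jfrac_denom r s 0 m = A 0 - Y"
      by (simp add: D_def)
    then show ?thesis
      using that by (simp add: Y_def fps_X_power_mult_nth)
  qed
  show ?thesis
    unfolding has_jfraction_def A_def[symmetric]
  proof (rule tendsto_fpsI)
    fix n
    show "\<forall>\<^sub>F m in sequentially. (1 / jfrac_denom r s 0 m) $ n = A 0 $ n"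
      using eventually_gt_at_top[of n] by eventually_elim (rule eq)
  qed
qed

section \<open>The three identities at the indeterminate\<close>

theorem proposition4p10:
  fixes \<delta> :: nat and Q T :: "nat \<Rightarrow> real poly"
  assumes "\<delta> > 0"
    and "Q 0 = 1"
    and "\<And>n. Q (Suc n) = of_nat \<delta> * [:0, 1:] * Q n + [:1, 0, 1:] * pderiv (Q n)"
    and "T (\<delta> - 1) = 1"
    and "\<And>n. n \<ge> \<delta> - 1 \<Longrightarrow>
           T (Suc n) =
             [:1 + (real n - real \<delta> + 1) / real \<delta>, 1, (real n - real \<delta> + 1) / real \<delta>:] * T n
             + smult (1 / real \<delta>) ([:1, -1, 1, -1:] * pderiv (T n))"
  shows "(\<forall>n. to_fract (Q n) =
            of_nat \<delta> ^ n * (1 + indet) ^ n / 2 ^ n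
              * subst_ratfun (T (n + \<delta> - 1)) ((indet - 1) / (indet + 1)))
       \<and> Abs_fps (\<lambda>n. to_fract (Q n) / fact n) =
            1 / (fps_cos 1 - fps_const indet * fps_sin 1) ^ \<delta>
       \<and> has_jfraction (Abs_fps (\<lambda>n. to_fract (Q n)))
            (\<lambda>i. of_nat (2 * i + \<delta>) * indet)
            (\<lambda>i. of_nat (i * (i + \<delta> - 1)) * (1 + indet ^ 2))"
proof (intro conjI allI)
  define x where "x = indet"
  define W where "W = fps_cos 1 - fps_const x * fps_sin 1"
  define V where "V = inverse W"
  define u where "u = (fps_sin 1 + fps_const x * fps_cos 1) * V"
  note derivs = secant_fps_derivs[of x, folded W_def, folded V_def, folded u_def]
  have u0: "u $ 0 = x" by (rule derivs)
  have Qx: "subst_ratfun p x = to_fract p" for p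
    unfolding x_def by (rule subst_ratfun_indet)
  \<comment> \<open>The indeterminate differs from -1, so \<open>1 + u\<close> has a nonzero
    constant term and is invertible.\<close>
  have "to_fract [:1, 1:] \<noteq> (0 :: ratfun)" by simp
  moreover have "to_fract [:1, 1:] = 1 + x"
    by (simp add: x_def indet_def flip: to_fract_1 to_fract_add) (simp add: one_pCons)
  ultimately have x1: "1 + x \<noteq> 0" by simp

  show "to_fract (Q n) = of_nat \<delta> ^ n * (1 + indet) ^ n / 2 ^ n
          * subst_ratfun (T (n + \<delta> - 1)) ((indet - 1) / (indet + 1))" for n
  proof -
    define e where "e = inverse (1 + u)"
    have e: "e * (1 + u) = 1"
      unfolding e_def by (rule inverse_mult_eq_1) (simp add: u0 x1)
    \<comment> \<open>At index \<open>n + \<delta> - 1\<close> the coefficient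
      \<open>n - \<delta> + 1\<close> becomes \<open>n\<close>; \<delta> > 0 keeps the natural
      subtraction exact.\<close>
    have T: "T (Suc n + \<delta> - 1) = [:1 + real n / real \<delta>, 1, real n / real \<delta>:] * T (n + \<delta> - 1)
             + smult (1 / real \<delta>) ([:1, -1, 1, -1:] * pderiv (T (n + \<delta> - 1)))" for n
    proof -
      have "real (n + \<delta> - 1) - real \<delta> + 1 = real n" "Suc n + \<delta> - 1 = Suc (n + \<delta> - 1)"
        using assms(1) by (auto simp: of_nat_diff)
      then show ?thesis using assms(5)[of "n + \<delta> - 1"] by simp
    qed
    have "2 ^ n * subst_fps (Q n) u =
        of_nat \<delta> ^ n * (1 + u) ^ n * subst_fps (T (n + \<delta> - 1)) (1 - 2 * e)"
      by (rule subst_fps_secant_tan_transform[where S = "\<lambda>n. T (n + \<delta> - 1)"])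
         (use derivs e assms T in simp_all)
    then have "(2 ^ n * subst_fps (Q n) u) $ 0 =
        (of_nat \<delta> ^ n * (1 + u) ^ n * subst_fps (T (n + \<delta> - 1)) (1 - 2 * e)) $ 0"
      by (rule arg_cong)
    then have "2 ^ n * to_fract (Q n) = of_nat \<delta> ^ n * (1 + x) ^ n * subst_ratfun (T (n + \<delta> - 1)) (1 - 2 * e $ 0)"
      by (simp add: fps_nth_power_0 subst_fps_nth_0 u0 Qx)
    moreover have "1 - 2 * e $ 0 = (x - 1) / (x + 1)"
      using x1 by (simp add: e_def u0 field_simps)
    ultimately have "2 ^ n * to_fract (Q n) =
        of_nat \<delta> ^ n * (1 + x) ^ n * subst_ratfun (T (n + \<delta> - 1)) ((x - 1) / (x + 1))"
      by (simp only:)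
    then show ?thesis
      unfolding x_def by (simp add: eq_divide_eq mult.commute)
  qed

  \<comment> \<open>Since \<open>V ^ \<delta>\<close> has logarithmic derivative
    \<open>\<delta> * u\<close>, one more derivative acts on the cofactor exactly as the recurrence
    of \<open>Q\<close>.\<close>
  have "(fps_deriv ^^ n) (V ^ \<delta>) = V ^ \<delta> * subst_fps (Q n) u" for n
  proof (induction n)
    case (Suc n)
    show ?case
      unfolding funpow.simps o_apply Suc subst_fps_secant_step[OF derivs(2) assms(3)]
      by (simp add: derivs(1) algebra_simps)
  qed (simp add: assms)
  then have "(fps_deriv ^^ n) (V ^ \<delta>) $ 0 = to_fract (Q n)" for n
    by (simp add: V_def W_def fps_nth_power_0 subst_fps_nth_0 u0 Qx)
  then have V_nth: "fact n * V ^ \<delta> $ n = to_fract (Q n)" for n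
    by (simp add: fps_0th_higher_deriv)
  have "1 / W ^ \<delta> = V ^ \<delta>"
    by (simp add: V_def W_def fps_divide_unit fps_nth_power_0 fps_inverse_power)
  moreover have "Abs_fps (\<lambda>n. to_fract (Q n) / fact n) = V ^ \<delta>"
    by (rule fps_ext) (simp flip: V_nth)
  ultimately show "Abs_fps (\<lambda>n. to_fract (Q n) / fact n) =
      1 / (fps_cos 1 - fps_const indet * fps_sin 1) ^ \<delta>"
    by (simp add: W_def x_def)

  define f where "f k = fps_const (1 / fact k) * V ^ (\<delta> + k) * fps_sin 1 ^ k" for k
  \<comment> \<open>The factor \<open>fact n\<close> turns differentiation into the shift from
    \<open>n\<close> to \<open>Suc n\<close>, so the equation for the derivative of
    \<open>f k\<close> becomes the recurrence of the criterion.\<close>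
  define a where "a k n = fact n * f k $ n" for k n
  define r where "r i = of_nat (2 * i + \<delta>) * x" for i
  define s where "s i = of_nat (i * (i + \<delta> - 1)) * (1 + x ^ 2)" for i
  have s_Suc: "s (Suc k) = of_nat (Suc k * (\<delta> + k)) * (1 + x ^ 2)" for k
    by (simp add: s_def add.commute del: of_nat_Suc of_nat_add of_nat_mult)
  have f': "fps_deriv (f k) = (if k = 0 then 0 else f (k - 1)) + fps_const (r k) * f k
      + fps_const (s (Suc k)) * f (Suc k)" for k
    unfolding f_def r_def s_Suc V_def W_def by (rule fps_deriv_secant_column)
  have "has_jfraction (Abs_fps (a 0)) r s"
  proof (rule has_jfractionI)
    show "a k 0 = (if k = 0 then 1 else 0)" for k
      by (simp add: a_def f_def V_def W_def fps_nth_power_0)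
    show "a k (Suc n) = (if k = 0 then 0 else a (k - 1) n) + r k * a k n + s (Suc k) * a (Suc k) n"
      for k n
    proof -
      have "a k (Suc n) = fact n * fps_deriv (f k) $ n"
        by (simp add: a_def algebra_simps)
      then show ?thesis unfolding f' by (simp add: a_def algebra_simps)
    qed
  qed
  \<comment> \<open>\<open>f 0\<close> is \<open>V ^ \<delta>\<close>, whose coefficients are known
    from (ii).\<close>
  moreover have "a 0 = (\<lambda>n. to_fract (Q n))"
    by (rule ext) (simp add: a_def f_def V_nth)
  ultimately show "has_jfraction (Abs_fps (\<lambda>n. to_fract (Q n)))
            (\<lambda>i. of_nat (2 * i + \<delta>) * indet)
            (\<lambda>i. of_nat (i * (i + \<delta> - 1)) * (1 + indet ^ 2))"
    by (simp add: r_def[abs_def] s_def[abs_def] x_def)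
qed

end
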